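(* Let $\Gamma$ be a finite connected graph on $V=\{1,\dots,n\}$ with symmetric weighted adjacency matrix $A=(a_{ij})$, let $\sigma\in[0,\infty)^n$, $U=\mathrm{diag}(\sigma_1,\dots,\sigma_n)$, and let $\lambda_n(U)$ be the largest eigenvalue of $H_U=\mathrm{Id}-D^{-1/2}(A-U)D^{-1/2}$. Write $d_i=\deg(i)$. Then \[ \max_{V_a,V_b}\left(1+\frac{1}{\mathcal{S}(\Gamma)}\Bigl(2\sum_{i\in V_a,\,j\in V_b}\frac{a_{ij}}{d_id_j}-\sum_{i,j\in V_a}\frac{a_{ij}}{d_id_j}-\sum_{i,j\in V_b}\frac{a_{ij}}{d_id_j}\Bigr)+\frac{\mathcal{S}_U(\Gamma,2)}{\mathcal{S}(\Gamma)}\right)\le\lambda_n(U), \] where the maximum is over all pairs $V_a,V_b\subset V$ with $V_a\cap V_b=\emptyset$ and $V_a\cup V_b=V$.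
   Context: $A$ has nonnegative real entries ($a_{ii}$ loop weights); $\deg(j)=\sum_i a_{ij}>0$, $D=\mathrm{diag}(\deg(1),\dots,\deg(n))$. The surface area is $\mathcal{S}(\Gamma)=\sum_{j=1}^n 1/\deg(j)$ and $\mathcal{S}_U(\Gamma,2)=\sum_{j=1}^n\sigma_j/\deg(j)^2$. In the paper the bracket is written as $2R_{-1}(\Gamma,V_a\times V_b)-R_{-1}(\Gamma,V_a)-R_{-1}(\Gamma,V_b)$ in terms of a restricted Randić index $R_{-1}(\Gamma,V_a\times V_b)$, $R_{-1}(\Gamma,\hat V)=R_{-1}(\Gamma,\hat V\times\hat V)$. *)

theory Defs
  imports
    "Jordan_Normal_Form.Spectral_Radius"
    "Graph_Theory.Pair_Digraph"
    "Graph_Theory.Digraph_Component"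
begin

text \<open>
  A weighted graph on \<open>n\<close> vertices is given by its adjacency matrix \<open>A\<close>;
  the vertex set \<open>{1, \<dots>, n}\<close> is represented by \<open>{..<n}\<close>.
\<close>

definition vertices :: "real mat \<Rightarrow> nat set" where
  "vertices A = {..<dim_row A}"

text \<open>
  The notion of connectedness used below, from the Graph Theory library, requires a nonempty
  vertex set.
\<close>

definition underlying_graph :: "real mat \<Rightarrow> nat pair_pre_digraph" where
  "underlying_graph A =
    \<lparr> pverts = vertices A,
      parcs = {(i, j). i \<in> vertices A \<and> j \<in> vertices A \<and> A $$ (i, j) \<noteq> 0} \<rparr>"

definition connected_graph :: "real mat \<Rightarrow> bool" where
  "connected_graph A \<longleftrightarrow> connected (with_proj (underlying_graph A))"

definition deg :: "real mat \<Rightarrow> nat \<Rightarrow> real" where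
  "deg A j = (\<Sum>i\<in>vertices A. A $$ (i, j))"

definition surface_area :: "real mat \<Rightarrow> real" where
  "surface_area A = (\<Sum>j\<in>vertices A. 1 / deg A j)"

definition surface_area2 :: "real mat \<Rightarrow> (nat \<Rightarrow> real) \<Rightarrow> real" where
  "surface_area2 A \<sigma> = (\<Sum>j\<in>vertices A. \<sigma> j / (deg A j)\<^sup>2)"

definition D_inv_sqrt :: "real mat \<Rightarrow> real mat" where
  "D_inv_sqrt A = mat_diag (dim_row A) (\<lambda>i. 1 / sqrt (deg A i))"

definition H_mat :: "real mat \<Rightarrow> (nat \<Rightarrow> real) \<Rightarrow> real mat" where
  "H_mat A \<sigma> = 1\<^sub>m (dim_row A)
     - D_inv_sqrt A * (A - mat_diag (dim_row A) \<sigma>) * D_inv_sqrt A"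

text \<open>
  Only applied to real symmetric matrices of positive dimension, all of whose eigenvalues are
  real, so that the maximum is taken over a finite nonempty set.
\<close>

definition largest_eigenvalue :: "real mat \<Rightarrow> real" where
  "largest_eigenvalue M = Max (spectrum M)"

end

theory Submission
  imports Defs "HOL-Analysis.Function_Topology"
begin

text \<open>
  The Rayleigh quotient of a real symmetric matrix attains its maximum on the unit sphere at an
  eigenvector, so it is bounded by the largest eigenvalue. For a partition of the vertices into
  \<open>V\<^sub>a\<close> and \<open>V\<^sub>b\<close>, the vector with entries \<open>1 / sqrt (deg i)\<close> on \<open>V\<^sub>a\<close> and \<open>- 1 / sqrt (deg i)\<close> on
  \<open>V\<^sub>b\<close> has squared norm \<open>surface_area A\<close>, and its Rayleigh quotient is the expression to be bounded.
\<close>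

section \<open>Maximising a quadratic form on the unit sphere\<close>

lemma linear_coeff_eq_0_if_quadratic_nonpos:
  fixes b c :: real
  assumes "\<And>t. 2 * t * b + t\<^sup>2 * c \<le> 0"
  shows "b = 0"
proof (rule ccontr)
  assume "b \<noteq> 0"
  \<comment> \<open>At \<open>t = b / m\<close> the quadratic takes the value b^2 (2m + c) / m^2, so
    any positive \<open>m\<close> with 2m + c > 0 refutes the assumption.\<close>
  define m where "m = \<bar>c\<bar> + 1"
  have m: "m > 0" "2 * m + c > 0" unfolding m_def by auto
  have "2 * (b / m) * b + (b / m)\<^sup>2 * c = b\<^sup>2 * (2 * m + c) / m\<^sup>2"
    using m by (simp add: field_simps power2_eq_square)
  also have "\<dots> > 0"
    using m \<open>b \<noteq> 0\<close> by simp
  finally show False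
    using assms[of "b / m"] by simp
qed

text \<open>A maximiser on the unit sphere exists by compactness. The first-order condition in each
  coordinate is the eigenvalue equation, with the maximum as eigenvalue, and homogeneity extends the
  bound to every vector.\<close>

lemma quadratic_form_max_eigenvector:
  fixes Q :: "nat \<Rightarrow> nat \<Rightarrow> real"
  assumes "n > 0" and sym: "\<And>i j. i < n \<Longrightarrow> j < n \<Longrightarrow> Q i j = Q j i"
  obtains \<mu> x where "(\<Sum>i<n. (x i)\<^sup>2) = 1"
    and "\<And>i. i < n \<Longrightarrow> (\<Sum>j<n. Q i j * x j) = \<mu> * x i"
    and "\<And>y. (\<Sum>i<n. \<Sum>j<n. Q i j * y i * y j) \<le> \<mu> * (\<Sum>i<n. (y i)\<^sup>2)"
proof -
  define q where "q y = (\<Sum>i<n. \<Sum>j<n. Q i j * y i * y j)" for y :: "nat \<Rightarrow> real"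
  define N where "N y = (\<Sum>i<n. (y i)\<^sup>2)" for y :: "nat \<Rightarrow> real"
  \<comment> \<open>Vectors are functions on all naturals. Pinning the coordinates from
    \<open>n\<close> on to 0 and boxing the others in [-1, 1] makes the product compact by
    Tychonoff; the box contains the unit sphere, so \<open>K\<close> is a copy of the sphere of
    R^n.\<close>
  define S where "S i = (if i < n then {-1..1} else {0 :: real})" for i :: nat
  define K where "K = PiE UNIV S \<inter> {y. N y = 1}"
  have "continuous_on UNIV N" "continuous_on UNIV q"
    unfolding N_def q_def by (intro continuous_intros continuous_on_product_coordinates)+
  have "compactin (product_topology (\<lambda>i. euclidean) UNIV) (PiE UNIV S)"
    unfolding compactin_PiE by (simp add: S_def)
  then have "compact (PiE UNIV S)"
    by (simp add: euclidean_product_topology)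
  moreover have "closed {y. N y = 1}"
    by (intro closed_Collect_eq \<open>continuous_on UNIV N\<close> continuous_intros)
  ultimately have "compact K"
    unfolding K_def by (rule compact_Int_closed)
  \<comment> \<open>The first basis vector shows that \<open>K\<close> is nonempty; it is a unit
    vector because \<open>n > 0\<close>.\<close>
  moreover have "(\<lambda>i. if i = 0 then 1 else 0) \<in> K"
    using \<open>n > 0\<close> by (auto simp: K_def S_def N_def if_distrib[of "\<lambda>u. u\<^sup>2"] cong: if_cong)
  ultimately obtain x where "x \<in> K" and max: "\<And>y. y \<in> K \<Longrightarrow> q y \<le> q x"
    using continuous_attains_sup[of K q] continuous_on_subset[OF \<open>continuous_on UNIV q\<close>, of K]
    by auto
  \<comment> \<open>Both \<open>q\<close> and \<open>N\<close> are homogeneous of degree 2, so a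
    nonzero \<open>y\<close> can be rescaled, and cut off beyond \<open>n\<close>, to a point
    \<open>z\<close> of \<open>K\<close>.\<close>
  have bound: "q y \<le> q x * N y" for y
  proof (cases "N y = 0")
    case True
    then have "\<forall>i<n. y i = 0"
      unfolding N_def by (subst (asm) sum_nonneg_eq_0_iff) auto
    then show ?thesis using True by (simp add: q_def)
  next
    case False
    moreover have "N y \<ge> 0" unfolding N_def by (simp add: sum_nonneg)
    ultimately have "N y > 0" by simp
    define s where "s = sqrt (N y)"
    have s: "s > 0" "s\<^sup>2 = N y" using \<open>N y > 0\<close> unfolding s_def by auto
    define z where "z i = (if i < n then y i / s else 0)" for i
    have "N z = N y / s\<^sup>2"
      unfolding N_def by (simp add: z_def sum_divide_distrib power_divide)
    then have "N z = 1" using s \<open>N y > 0\<close> by simp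
    have "- 1 \<le> z i \<and> z i \<le> 1" if "i < n" for i
    proof -
      have "(z i)\<^sup>2 \<le> N z"
        unfolding N_def using that by (intro member_le_sum) auto
      then show ?thesis using \<open>N z = 1\<close> using abs_square_le_1[of "z i"] by (simp add: abs_le_iff)
    qed
    moreover have "z i = 0" if "\<not> i < n" for i
      using that by (simp add: z_def)
    ultimately have "z \<in> K"
      using \<open>N z = 1\<close> by (auto simp: K_def S_def PiE_UNIV_domain)
    then have "q z \<le> q x" by (rule max)
    moreover have "q z = q y / s\<^sup>2"
      unfolding q_def by (simp add: z_def sum_divide_distrib power2_eq_square)
    ultimately show ?thesis using s \<open>N y > 0\<close> by (simp add: field_simps)
  qed
  have "N x = 1" using \<open>x \<in> K\<close> by (simp add: K_def)
  have "(\<Sum>j<n. Q k j * x j) = q x * x k" if "k < n" for k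
  proof -
    define g where "g = (\<Sum>j<n. Q k j * x j)"
    \<comment> \<open>Moving \<open>x\<close> by \<open>t\<close> in coordinate \<open>k\<close>
      gives a vector \<open>y\<close> for which the left side is exactly
      \<open>q y - q x * N y\<close>. Its linear coefficient must vanish, which is row
      \<open>k\<close> of the eigenvalue equation.\<close>
    have "2 * t * (g - q x * x k) + t\<^sup>2 * (Q k k - q x) \<le> 0" for t
    proof -
      define y where "y i = x i + (if i = k then t else 0)" for i
      have "N y = (\<Sum>i<n. (x i)\<^sup>2 + (if i = k then 2 * t * x k + t\<^sup>2 else 0))"
        unfolding N_def y_def by (intro sum.cong) (auto simp: power2_sum)
      also have "\<dots> = 1 + 2 * t * x k + t\<^sup>2"
        using \<open>k < n\<close> \<open>N x = 1\<close> by (simp add: sum.distrib N_def)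
      finally have Ny: "N y = 1 + 2 * t * x k + t\<^sup>2" .
      have row: "(\<Sum>j<n. Q i j * y i * y j) = y i * (\<Sum>j<n. Q i j * x j) + y i * (Q i k * t)" for i
      proof -
        have "(\<Sum>j<n. Q i j * y i * y j)
            = (\<Sum>j<n. y i * (Q i j * x j) + (if j = k then y i * (Q i k * t) else 0))"
          by (intro sum.cong) (auto simp: y_def[of k] y_def algebra_simps)
        then show ?thesis
          using \<open>k < n\<close> by (simp add: sum.distrib sum_distrib_left)
      qed
      \<comment> \<open>Symmetry turns column \<open>k\<close> of \<open>Q\<close> into row
        \<open>k\<close>, so both cross terms sum to \<open>t * g\<close>.\<close>
      have "q y = (\<Sum>i<n. x i * (\<Sum>j<n. Q i j * x j) + Q k i * x i * t
               + (if i = k then t * g + t\<^sup>2 * Q k k else 0))"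
        unfolding q_def row
      proof (intro sum.cong refl)
        fix i assume "i \<in> {..<n}"
        then have "Q i k = Q k i" using sym \<open>k < n\<close> by simp
        then show "y i * (\<Sum>j<n. Q i j * x j) + y i * (Q i k * t)
            = x i * (\<Sum>j<n. Q i j * x j) + Q k i * x i * t
               + (if i = k then t * g + t\<^sup>2 * Q k k else 0)"
          by (cases "i = k") (simp_all add: y_def g_def algebra_simps power2_eq_square)
      qed
      also have "\<dots> = q x + g * t + (t * g + t\<^sup>2 * Q k k)"
        using \<open>k < n\<close>
        by (simp add: sum.distrib q_def g_def sum_distrib_left sum_distrib_right ac_simps)
      finally have "q y = q x + 2 * t * g + t\<^sup>2 * Q k k" by simp
      with bound[of y] Ny show ?thesis by (simp add: algebra_simps)
    qed
    then have "g - q x * x k = 0" by (rule linear_coeff_eq_0_if_quadratic_nonpos)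
    then show ?thesis by (simp add: g_def)
  qed
  then show thesis
    using that \<open>N x = 1\<close> bound unfolding N_def q_def by blast
qed

text \<open>The maximum of the form on the unit sphere is itself an eigenvalue, hence at most the
  largest element of the finite spectrum.\<close>

lemma quadratic_form_le_Max_spectrum:
  fixes M :: "real mat"
  assumes M: "M \<in> carrier_mat n n" and "n > 0"
    and sym: "\<And>i j. i < n \<Longrightarrow> j < n \<Longrightarrow> M $$ (i, j) = M $$ (j, i)"
  shows "(\<Sum>i<n. \<Sum>j<n. M $$ (i, j) * y i * y j) \<le> Max (spectrum M) * (\<Sum>i<n. (y i)\<^sup>2)"
proof -
  obtain \<mu> x where x: "(\<Sum>i<n. (x i)\<^sup>2) = 1"
    and eig: "\<And>i. i < n \<Longrightarrow> (\<Sum>j<n. M $$ (i, j) * x j) = \<mu> * x i"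
    and bound: "\<And>y. (\<Sum>i<n. \<Sum>j<n. M $$ (i, j) * y i * y j) \<le> \<mu> * (\<Sum>i<n. (y i)\<^sup>2)"
    by (rule quadratic_form_max_eigenvector[of n "\<lambda>i j. M $$ (i, j)"])
      (use \<open>n > 0\<close> sym in auto)
  have "eigenvector M (vec n x) \<mu>"
    unfolding eigenvector_def
  proof (intro conjI)
    show "vec n x \<in> carrier_vec (dim_row M)" using M by simp
    show "vec n x \<noteq> 0\<^sub>v (dim_row M)"
    proof
      assume "vec n x = 0\<^sub>v (dim_row M)"
      then have "x i = 0" if "i < n" for i
        using that M by (metis carrier_matD(1) index_vec index_zero_vec(1))
      then show False using x by simp
    qed
    show "M *\<^sub>v vec n x = \<mu> \<cdot>\<^sub>v vec n x"
      using M by (intro eq_vecI) (auto simp: scalar_prod_def atLeast0LessThan eig)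
  qed
  then have "\<mu> \<in> spectrum M"
    by (auto simp: spectrum_def eigenvalue_def)
  then have "\<mu> \<le> Max (spectrum M)"
    using card_finite_spectrum(1)[OF M] by simp
  then have "\<mu> * (\<Sum>i<n. (y i)\<^sup>2) \<le> Max (spectrum M) * (\<Sum>i<n. (y i)\<^sup>2)"
    by (intro mult_right_mono sum_nonneg) auto
  with bound[of y] show ?thesis by linarith
qed

section \<open>The Rayleigh quotient of the sign vector of a partition\<close>

lemma H_mat_carrier:
  assumes "A \<in> carrier_mat n n"
  shows "H_mat A \<sigma> \<in> carrier_mat n n"
  using assms by (auto simp: H_mat_def D_inv_sqrt_def mat_diag_def)

lemma H_mat_index:
  assumes A: "A \<in> carrier_mat n n" and "i < n" "j < n"
  shows "H_mat A \<sigma> $$ (i, j) = (if i = j then 1 else 0)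
    - (A $$ (i, j) - (if i = j then \<sigma> j else 0)) / (sqrt (deg A i) * sqrt (deg A j))"
proof -
  have B: "A - mat_diag n \<sigma> \<in> carrier_mat n n"
    using A by (intro minus_carrier_mat mat_diag_dim)
  show ?thesis
    unfolding H_mat_def D_inv_sqrt_def carrier_matD(1)[OF A] mat_diag_mult_left[OF B]
    using assms by (subst mat_diag_mult_right[of _ n]) (auto simp: mat_diag_def)
qed

text \<open>The product \<open>s i * s j\<close> is 1 on the two diagonal blocks and -1 on the two
  mixed blocks; symmetry makes the mixed blocks equal, whence the factor 2.\<close>

lemma sum_signed_partition:
  fixes f :: "'a \<Rightarrow> 'a \<Rightarrow> real"
  assumes "finite P" "finite R" "P \<inter> R = {}"
    and sym: "\<And>i j. i \<in> P \<Longrightarrow> j \<in> R \<Longrightarrow> f i j = f j i"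
    and s: "s = (\<lambda>i. if i \<in> P then 1 else - 1)"
  shows "(\<Sum>i\<in>P \<union> R. \<Sum>j\<in>P \<union> R. s i * s j * f i j)
    = (\<Sum>i\<in>P. \<Sum>j\<in>P. f i j) + (\<Sum>i\<in>R. \<Sum>j\<in>R. f i j) - 2 * (\<Sum>i\<in>P. \<Sum>j\<in>R. f i j)"
proof -
  have s_P: "s i = 1" if "i \<in> P" for i using that by (simp add: s)
  have s_R: "s i = - 1" if "i \<in> R" for i using that assms(3) by (auto simp: s)
  have "(\<Sum>i\<in>R. \<Sum>j\<in>P. f i j) = (\<Sum>i\<in>P. \<Sum>j\<in>R. f i j)"
    by (subst sum.swap) (auto intro!: sum.cong simp: sym)
  then show ?thesis
    by (simp add: sum.union_disjoint[OF assms(1-3)] s_P s_R sum_subtractf sum_negf)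
qed

text \<open>In the quadratic form at \<open>y\<close>, the identity contributes
  \<open>surface_area A\<close>, the potential contributes \<open>surface_area2 A \<sigma>\<close>,
  and the adjacency matrix contributes the bracket. Dividing by the squared norm gives the bound;
  one block may be empty.\<close>

lemma signed_partition_le_largest_eigenvalue:
  fixes A :: "real mat"
  assumes A: "A \<in> carrier_mat n n" and "n > 0"
    and sym: "\<And>i j. i < n \<Longrightarrow> j < n \<Longrightarrow> A $$ (i, j) = A $$ (j, i)"
    and deg: "\<And>j. j < n \<Longrightarrow> 0 < deg A j"
    and PR: "P \<inter> R = {}" "P \<union> R = {..<n}"
  shows "1 + 1 / surface_area A *
                  (2 * (\<Sum>i\<in>P. \<Sum>j\<in>R. A $$ (i, j) / (deg A i * deg A j))
                     - (\<Sum>i\<in>P. \<Sum>j\<in>P. A $$ (i, j) / (deg A i * deg A j))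
                     - (\<Sum>i\<in>R. \<Sum>j\<in>R. A $$ (i, j) / (deg A i * deg A j)))
              + surface_area2 A \<sigma> / surface_area A \<le> largest_eigenvalue (H_mat A \<sigma>)"
    (is "1 + 1 / ?S * ?E + ?S2 / ?S \<le> ?L")
proof -
  let ?d = "deg A"
  define s :: "nat \<Rightarrow> real" where "s = (\<lambda>i. if i \<in> P then 1 else - 1)"
  define y where "y i = s i / sqrt (?d i)" for i
  define f where "f i j = A $$ (i, j) / (?d i * ?d j)" for i j
  have V: "vertices A = {..<n}" using A by (simp add: vertices_def)
  have ss: "s i * s i = 1" for i by (simp add: s_def)
  have S: "?S = (\<Sum>i<n. 1 / ?d i)" by (simp add: surface_area_def V)
  have "?S > 0"
    unfolding S using deg \<open>n > 0\<close> by (intro sum_pos) auto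
  have y2: "(y i)\<^sup>2 = 1 / ?d i" if "i < n" for i
    using deg[OF that] ss[of i] by (simp add: y_def power_divide power2_eq_square)
  have norm: "(\<Sum>i<n. (y i)\<^sup>2) = ?S"
    unfolding S using y2 by (intro sum.cong) auto
  have fin: "finite P" "finite R"
    using PR(2) by (metis finite_Un finite_lessThan)+
  \<comment> \<open>The square roots in \<open>y\<close> pair with those in the matrix entry,
    leaving whole degrees; on the diagonal the signs square to 1.\<close>
  have entry: "H_mat A \<sigma> $$ (i, j) * y i * y j
      = (if j = i then 1 / ?d i + \<sigma> i / (?d i)\<^sup>2 else 0) - s i * s j * f i j"
    if "i < n" "j < n" for i j
  proof -
    have d: "?d i > 0" "?d j > 0" using deg that by auto
    have "y i * y j / (sqrt (?d i) * sqrt (?d j))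
        = s i * s j / ((sqrt (?d i) * sqrt (?d i)) * (sqrt (?d j) * sqrt (?d j)))"
      unfolding y_def times_divide_times_eq divide_divide_eq_left by (simp only: ac_simps)
    also have "\<dots> = s i * s j / (?d i * ?d j)"
      using d by simp
    finally have yy: "y i * y j / (sqrt (?d i) * sqrt (?d j)) = s i * s j / (?d i * ?d j)" .
    have "H_mat A \<sigma> $$ (i, j) * y i * y j = (if j = i then (y i)\<^sup>2 else 0)
        - (A $$ (i, j) - (if j = i then \<sigma> i else 0)) * (y i * y j / (sqrt (?d i) * sqrt (?d j)))"
      unfolding H_mat_index[OF A that] by (auto simp: algebra_simps power2_eq_square)
    then show ?thesis
      unfolding yy using ss[of i] y2[OF that(1)]
      by (auto simp: f_def diff_divide_distrib left_diff_distrib power2_eq_square)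
  qed
  have "(\<Sum>i<n. \<Sum>j<n. H_mat A \<sigma> $$ (i, j) * y i * y j)
      = (\<Sum>i<n. 1 / ?d i + \<sigma> i / (?d i)\<^sup>2) - (\<Sum>i<n. \<Sum>j<n. s i * s j * f i j)"
    by (simp add: entry sum_subtractf)
  also have "(\<Sum>i<n. 1 / ?d i + \<sigma> i / (?d i)\<^sup>2) = ?S + ?S2"
    by (simp add: S surface_area2_def V sum.distrib)
  also have "(\<Sum>i<n. \<Sum>j<n. s i * s j * f i j) = - ?E"
  proof -
    have "f i j = f j i" if "i \<in> P" "j \<in> R" for i j
    proof -
      have "i < n" "j < n" using that PR(2) by auto
      then show ?thesis by (simp add: f_def sym[of i j] mult.commute)
    qed
    from sum_signed_partition[where f = f, OF fin PR(1) this s_def]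
    show ?thesis unfolding PR(2) by (simp add: f_def)
  qed
  finally have "(\<Sum>i<n. \<Sum>j<n. H_mat A \<sigma> $$ (i, j) * y i * y j) = ?S + ?S2 + ?E" by simp
  moreover have "H_mat A \<sigma> $$ (i, j) = H_mat A \<sigma> $$ (j, i)" if "i < n" "j < n" for i j
    using that sym[of i j] by (simp add: H_mat_index[OF A] mult.commute)
  ultimately have "?S + ?S2 + ?E \<le> ?L * ?S"
    using quadratic_form_le_Max_spectrum[OF H_mat_carrier[OF A] \<open>n > 0\<close>, of \<sigma> y]
    by (simp only: norm largest_eigenvalue_def)
  then have "(?S + ?S2 + ?E) / ?S \<le> ?L"
    using \<open>?S > 0\<close> by (simp add: pos_divide_le_eq)
  moreover have "(?S + ?S2 + ?E) / ?S = 1 + 1 / ?S * ?E + ?S2 / ?S"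
    using \<open>?S > 0\<close> by (simp add: add_divide_distrib)
  ultimately show ?thesis by simp
qed

theorem mainTheorem8:
  fixes n :: nat and A :: "real mat" and \<sigma> :: "nat \<Rightarrow> real"
  assumes "A \<in> carrier_mat n n"
    and "\<And>i j. i < n \<Longrightarrow> j < n \<Longrightarrow> 0 \<le> A $$ (i, j)"
    and "\<And>i j. i < n \<Longrightarrow> j < n \<Longrightarrow> A $$ (i, j) = A $$ (j, i)"
    and "connected_graph A"
    and "\<And>j. j < n \<Longrightarrow> 0 < deg A j"
    and "\<And>j. j < n \<Longrightarrow> 0 \<le> \<sigma> j"
  shows "(MAX (V\<^sub>a, V\<^sub>b) \<in> {(V\<^sub>a, V\<^sub>b). V\<^sub>a \<subseteq> vertices A \<and> V\<^sub>b \<subseteq> vertices A \<and>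
              V\<^sub>a \<inter> V\<^sub>b = {} \<and> V\<^sub>a \<union> V\<^sub>b = vertices A}.
            1 + 1 / surface_area A *
                  (2 * (\<Sum>i\<in>V\<^sub>a. \<Sum>j\<in>V\<^sub>b. A $$ (i, j) / (deg A i * deg A j))
                     - (\<Sum>i\<in>V\<^sub>a. \<Sum>j\<in>V\<^sub>a. A $$ (i, j) / (deg A i * deg A j))
                     - (\<Sum>i\<in>V\<^sub>b. \<Sum>j\<in>V\<^sub>b. A $$ (i, j) / (deg A i * deg A j)))
              + surface_area2 A \<sigma> / surface_area A)
         \<le> largest_eigenvalue (H_mat A \<sigma>)"
proof -
  have V: "vertices A = {..<n}" using assms(1) by (simp add: vertices_def)
  \<comment> \<open>Connectedness enters here: it includes a nonempty vertex set, hence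
    \<open>n > 0\<close>.\<close>
  have "pverts (underlying_graph A) \<noteq> {}"
    using assms(4) unfolding connected_graph_def connected_def strongly_connected_def by auto
  then have "n > 0" by (auto simp: underlying_graph_def V)
  let ?X = "{(V\<^sub>a, V\<^sub>b). V\<^sub>a \<subseteq> vertices A \<and> V\<^sub>b \<subseteq> vertices A \<and>
              V\<^sub>a \<inter> V\<^sub>b = {} \<and> V\<^sub>a \<union> V\<^sub>b = vertices A}"
  \<comment> \<open>Bounding \<open>Max\<close> by a bound on each element requires a finite
    nonempty set; the trivial partition is the witness for the latter.\<close>
  have "?X \<subseteq> Pow (vertices A) \<times> Pow (vertices A)" by auto
  then have "finite ?X" by (rule finite_subset) (simp add: V)
  moreover have "({}, vertices A) \<in> ?X" by simp
  ultimately show ?thesis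
    using signed_partition_le_largest_eigenvalue[OF assms(1) \<open>n > 0\<close> assms(3,5)]
    by (subst Max_le_iff) (auto simp: V)
qed

end
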